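(* Let $\mathbb{E}: K\xrightarrow{k}X\xrightarrow{f}M$ be a Schreier extension of monoids with $K$ commutative. Let $R_{\mathbb{E}}=\{(x,z)\in X\times X: z=k(a)+x\text{ for some }a\in K\}$, let $\mathrm{Eq}(f)=\{(x,y)\in X\times X: f(x)=f(y)\}$, let $j\colon R_{\mathbb{E}}\to \mathrm{Eq}(f)$ be the inclusion, and let $k_2\colon K\to\mathrm{Eq}(f)$, $k_2(a)=(k(a),0)$. The following statements are equivalent: (1) $k_2$ factors through $j$; (2) $j$ is an isomorphism; (3) the relation $R_{\mathbb{E}}$ is symmetric; (4) $K$ is a group.
   Context: Monoids $K,X$ are written additively ($X$ is not assumed commutative) and $M$ multiplicatively with unit $1$. A monoid extension $K\xrightarrow{k}X\xrightarrow{f}M$ consists of a surjective monoid homomorphism $f$ and a kernel $(K,k)$ of $f$ (so $k$ is injective with image $\{x: f(x)=1\}$). It is a Schreier extension if for every $m\in M$ there is $u\in f^{-1}(m)$ such that for every $x\in f^{-1}(m)$ there is a unique $a\in K$ with $x=k(a)+u$. $R_{\mathbb{E}}$ is a submonoid of $X\times X$ contained in $\mathrm{Eq}(f)$. *)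

theory Defs
  imports "HOL-Algebra.Coset"
begin

text \<open>All monoids are written multiplicatively here: the additive \<open>k(a) + x\<close> of the usual
  presentation of Schreier extensions is \<open>k a \<otimes>\<^bsub>X\<^esub> x\<close>, and \<open>0\<close> is \<open>\<one>\<^bsub>X\<^esub>\<close>.\<close>

text \<open>The library's \<^const>\<open>hom\<close> does not require the unit to be preserved, which is not automatic
  for monoids.\<close>

definition monoid_hom ::
    "('a, 'm) monoid_scheme \<Rightarrow> ('b, 'n) monoid_scheme \<Rightarrow> ('a \<Rightarrow> 'b) set" where
  "monoid_hom G H = {h \<in> hom G H. h \<one>\<^bsub>G\<^esub> = \<one>\<^bsub>H\<^esub>}"

locale monoid_extension =
  fixes K :: "('a, 'k) monoid_scheme"
    and X :: "('b, 'x) monoid_scheme"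
    and M :: "('c, 'm) monoid_scheme"
    and k :: "'a \<Rightarrow> 'b" and f :: "'b \<Rightarrow> 'c"
  assumes monoid_K: "monoid K" and monoid_X: "monoid X" and monoid_M: "monoid M"
    and k_hom: "k \<in> monoid_hom K X"
    and k_inj: "inj_on k (carrier K)"
    and k_image: "k ` carrier K = kernel X M f"
    and f_hom: "f \<in> monoid_hom X M"
    and f_surj: "f ` carrier X = carrier M"

locale schreier_extension = monoid_extension +
  assumes schreier: "\<forall>m\<in>carrier M. \<exists>u\<in>carrier X. f u = m \<and>
    (\<forall>x\<in>carrier X. f x = m \<longrightarrow> (\<exists>!a. a \<in> carrier K \<and> x = k a \<otimes>\<^bsub>X\<^esub> u))"

definition R_rel ::
    "('a, 'k) monoid_scheme \<Rightarrow> ('b, 'x) monoid_scheme \<Rightarrow> ('a \<Rightarrow> 'b) \<Rightarrow> ('b \<times> 'b) set" where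
  "R_rel K X k = {(x, z). x \<in> carrier X \<and> z \<in> carrier X \<and> (\<exists>a\<in>carrier K. z = k a \<otimes>\<^bsub>X\<^esub> x)}"

definition Eq_rel :: "('b, 'x) monoid_scheme \<Rightarrow> ('b \<Rightarrow> 'c) \<Rightarrow> ('b \<times> 'b) set" where
  "Eq_rel X f = {(x, y). x \<in> carrier X \<and> y \<in> carrier X \<and> f x = f y}"

definition R_monoid ::
    "('a, 'k) monoid_scheme \<Rightarrow> ('b, 'x) monoid_scheme \<Rightarrow> ('a \<Rightarrow> 'b) \<Rightarrow> ('b \<times> 'b) monoid" where
  "R_monoid K X k = (X \<times>\<times> X)\<lparr>carrier := R_rel K X k\<rparr>"

definition Eq_monoid :: "('b, 'x) monoid_scheme \<Rightarrow> ('b \<Rightarrow> 'c) \<Rightarrow> ('b \<times> 'b) monoid" where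
  "Eq_monoid X f = (X \<times>\<times> X)\<lparr>carrier := Eq_rel X f\<rparr>"

text \<open>The inclusion of \<^const>\<open>R_monoid\<close> in \<^const>\<open>Eq_monoid\<close>; as a HOL function it is the
  identity on pairs, its domain and codomain being supplied by the monoids it is used with.\<close>

definition j_incl :: "'b \<times> 'b \<Rightarrow> 'b \<times> 'b" where
  "j_incl p = p"

definition k2 :: "('b, 'x) monoid_scheme \<Rightarrow> ('a \<Rightarrow> 'b) \<Rightarrow> 'a \<Rightarrow> 'b \<times> 'b" where
  "k2 X k a = (k a, \<one>\<^bsub>X\<^esub>)"

definition factors_through ::
    "('a, 'k) monoid_scheme \<Rightarrow> ('d, 'n) monoid_scheme \<Rightarrow> ('a \<Rightarrow> 'e) \<Rightarrow> ('d \<Rightarrow> 'e) \<Rightarrow> bool" where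
  "factors_through A B g i \<longleftrightarrow> (\<exists>h\<in>monoid_hom A B. \<forall>a\<in>carrier A. g a = i (h a))"

context monoid_extension
begin

lemma k_closed: "a \<in> carrier K \<Longrightarrow> k a \<in> carrier X"
  using k_hom by (auto simp: monoid_hom_def hom_def)

lemma k_one: "k \<one>\<^bsub>K\<^esub> = \<one>\<^bsub>X\<^esub>"
  using k_hom by (simp add: monoid_hom_def)

lemma k_mult: "\<lbrakk>a \<in> carrier K; b \<in> carrier K\<rbrakk> \<Longrightarrow> k (a \<otimes>\<^bsub>K\<^esub> b) = k a \<otimes>\<^bsub>X\<^esub> k b"
  using k_hom by (auto simp: monoid_hom_def hom_def)

lemma f_closed: "x \<in> carrier X \<Longrightarrow> f x \<in> carrier M"
  using f_hom by (auto simp: monoid_hom_def hom_def)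

lemma f_one: "f \<one>\<^bsub>X\<^esub> = \<one>\<^bsub>M\<^esub>"
  using f_hom by (simp add: monoid_hom_def)

lemma f_mult: "\<lbrakk>x \<in> carrier X; y \<in> carrier X\<rbrakk> \<Longrightarrow> f (x \<otimes>\<^bsub>X\<^esub> y) = f x \<otimes>\<^bsub>M\<^esub> f y"
  using f_hom by (auto simp: monoid_hom_def hom_def)

lemma f_k: "a \<in> carrier K \<Longrightarrow> f (k a) = \<one>\<^bsub>M\<^esub>"
  using k_image by (auto simp: kernel_def)

lemma R_rel_subset_Eq_rel: "R_rel K X k \<subseteq> Eq_rel X f"
  by (auto simp: R_rel_def Eq_rel_def f_mult f_k k_closed monoid.l_one[OF monoid_M] f_closed)

lemma submonoid_Eq_rel: "submonoid (Eq_rel X f) (X \<times>\<times> X)"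
  by (rule submonoid.intro)
    (auto simp: Eq_rel_def f_mult monoid.m_closed[OF monoid_X] monoid.one_closed[OF monoid_X])

lemma k2_hom: "k2 X k \<in> monoid_hom K (Eq_monoid X f)"
  by (auto simp: monoid_hom_def hom_def k2_def Eq_monoid_def Eq_rel_def k_closed k_one k_mult
      f_k f_one monoid.one_closed[OF monoid_X] monoid.l_one[OF monoid_X])

end

context schreier_extension
begin

lemma conjugate:
  assumes "comm_monoid K" and x: "x \<in> carrier X" and b: "b \<in> carrier K"
  shows "\<exists>c\<in>carrier K. x \<otimes>\<^bsub>X\<^esub> k b = k c \<otimes>\<^bsub>X\<^esub> x"
proof -
  interpret X: monoid X by (rule monoid_X)
  interpret K: comm_monoid K by fact
  obtain u where u: "u \<in> carrier X" "f u = f x"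
    and ex: "\<And>y. \<lbrakk>y \<in> carrier X; f y = f x\<rbrakk> \<Longrightarrow> \<exists>a. a \<in> carrier K \<and> y = k a \<otimes>\<^bsub>X\<^esub> u"
    using schreier f_closed[OF x] by (metis (no_types, lifting))
  obtain a where a: "a \<in> carrier K" "x = k a \<otimes>\<^bsub>X\<^esub> u" using ex x by blast
  have "f (u \<otimes>\<^bsub>X\<^esub> k b) = f x"
    using u b x by (simp add: f_mult f_k k_closed f_closed monoid.r_one[OF monoid_M])
  then obtain c where c: "c \<in> carrier K" "u \<otimes>\<^bsub>X\<^esub> k b = k c \<otimes>\<^bsub>X\<^esub> u"
    using ex u b k_closed by blast
  have "x \<otimes>\<^bsub>X\<^esub> k b = k (a \<otimes>\<^bsub>K\<^esub> c) \<otimes>\<^bsub>X\<^esub> u"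
    using a c u b by (simp add: X.m_assoc k_closed k_mult)
  also have "\<dots> = k (c \<otimes>\<^bsub>K\<^esub> a) \<otimes>\<^bsub>X\<^esub> u"
    using a c by (simp add: K.m_comm)
  also have "\<dots> = k c \<otimes>\<^bsub>X\<^esub> x"
    using a c u by (simp add: X.m_assoc k_closed k_mult)
  finally show ?thesis using c by blast
qed

lemma submonoid_R_rel:
  assumes "comm_monoid K"
  shows "submonoid (R_rel K X k) (X \<times>\<times> X)"
proof (rule submonoid.intro)
  interpret X: monoid X by (rule monoid_X)
  interpret K: comm_monoid K by fact
  show "R_rel K X k \<subseteq> carrier (X \<times>\<times> X)" by (auto simp: R_rel_def)
  show "\<one>\<^bsub>X \<times>\<times> X\<^esub> \<in> R_rel K X k"
    by (auto simp: R_rel_def k_one intro!: bexI[of _ "\<one>\<^bsub>K\<^esub>"])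
  fix p q assume "p \<in> R_rel K X k" "q \<in> R_rel K X k"
  then obtain x a y b where p: "p = (x, k a \<otimes>\<^bsub>X\<^esub> x)" "x \<in> carrier X" "a \<in> carrier K"
    and q: "q = (y, k b \<otimes>\<^bsub>X\<^esub> y)" "y \<in> carrier X" "b \<in> carrier K"
    by (auto simp: R_rel_def)
  obtain c where c: "c \<in> carrier K" "x \<otimes>\<^bsub>X\<^esub> k b = k c \<otimes>\<^bsub>X\<^esub> x"
    using conjugate[OF assms p(2) q(3)] by blast
  have "(k a \<otimes>\<^bsub>X\<^esub> x) \<otimes>\<^bsub>X\<^esub> (k b \<otimes>\<^bsub>X\<^esub> y) = k a \<otimes>\<^bsub>X\<^esub> ((x \<otimes>\<^bsub>X\<^esub> k b) \<otimes>\<^bsub>X\<^esub> y)"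
    using p q by (simp add: X.m_assoc k_closed)
  also have "\<dots> = k (a \<otimes>\<^bsub>K\<^esub> c) \<otimes>\<^bsub>X\<^esub> (x \<otimes>\<^bsub>X\<^esub> y)"
    using p q c by (simp add: X.m_assoc k_closed k_mult)
  finally have eq: "(k a \<otimes>\<^bsub>X\<^esub> x) \<otimes>\<^bsub>X\<^esub> (k b \<otimes>\<^bsub>X\<^esub> y) = k (a \<otimes>\<^bsub>K\<^esub> c) \<otimes>\<^bsub>X\<^esub> (x \<otimes>\<^bsub>X\<^esub> y)" .
  have "a \<otimes>\<^bsub>K\<^esub> c \<in> carrier K" using p c by simp
  then show "p \<otimes>\<^bsub>X \<times>\<times> X\<^esub> q \<in> R_rel K X k"
    using p q eq by (auto simp: R_rel_def k_closed)
qed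

lemma j_incl_hom: "j_incl \<in> monoid_hom (R_monoid K X k) (Eq_monoid X f)"
  using R_rel_subset_Eq_rel
  by (auto simp: monoid_hom_def hom_def j_incl_def R_monoid_def Eq_monoid_def)

end

end

(* Each condition says that every pair (k a, 1) lies in R. Since such a membership means
   1 = k b * k a = k (b * a), it provides a left inverse b of a. Conversely, if K is a group and
   f x = f y, write x = k a * u and y = k b * u with a Schreier generator u; then
   y = k (b * a^-1) * x, so R is all of Eq(f). *)

theory Submission
  imports Defs
begin

context monoid_extension
begin

text \<open>Injectivity of \<open>k\<close> brings the equation \<open>k b * k a = 1\<close> back
  from \<open>X\<close> to \<open>K\<close>.\<close>

lemma k2_in_R_rel_iff:
  assumes "a \<in> carrier K"
  shows "k2 X k a \<in> R_rel K X k \<longleftrightarrow> (\<exists>b\<in>carrier K. b \<otimes>\<^bsub>K\<^esub> a = \<one>\<^bsub>K\<^esub>)"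
proof -
  interpret X: monoid X by (rule monoid_X)
  interpret K: monoid K by (rule monoid_K)
  have "\<one>\<^bsub>X\<^esub> = k b \<otimes>\<^bsub>X\<^esub> k a \<longleftrightarrow> b \<otimes>\<^bsub>K\<^esub> a = \<one>\<^bsub>K\<^esub>" if "b \<in> carrier K" for b
    using that assms inj_on_eq_iff[OF k_inj, of "b \<otimes>\<^bsub>K\<^esub> a" "\<one>\<^bsub>K\<^esub>"]
    by (auto simp: k_mult k_one)
  then show ?thesis
    using assms by (auto simp: k2_def R_rel_def k_closed)
qed

text \<open>A monoid in which every element has a left inverse is a group.\<close>

lemma group_K_iff_k2_in_R_rel: "group K \<longleftrightarrow> k2 X k ` carrier K \<subseteq> R_rel K X k"
proof
  assume "group K"
  then show "k2 X k ` carrier K \<subseteq> R_rel K X k"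
    using k2_in_R_rel_iff group.l_inv_ex by fastforce
next
  assume "k2 X k ` carrier K \<subseteq> R_rel K X k"
  then show "group K"
    using monoid_K k2_in_R_rel_iff
    by (intro groupI) (auto intro: monoid.m_closed simp: monoid.m_assoc)
qed

text \<open>Since \<open>j_incl\<close> is the identity on pairs, the only possible factor is
  \<open>k2\<close> itself. It is a homomorphism as soon as its values lie in \<open>R_rel\<close>,
  because both relations carry the operation and unit of the product.\<close>

lemma factors_through_j_incl_iff:
  "factors_through K (R_monoid K X k) (k2 X k) j_incl \<longleftrightarrow> k2 X k ` carrier K \<subseteq> R_rel K X k"
proof
  assume "factors_through K (R_monoid K X k) (k2 X k) j_incl"
  then show "k2 X k ` carrier K \<subseteq> R_rel K X k"
    by (force simp: factors_through_def j_incl_def monoid_hom_def hom_def R_monoid_def)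
next
  assume "k2 X k ` carrier K \<subseteq> R_rel K X k"
  then have "k2 X k \<in> monoid_hom K (R_monoid K X k)"
    using k2_hom by (auto simp: monoid_hom_def hom_def R_monoid_def Eq_monoid_def)
  then show "factors_through K (R_monoid K X k) (k2 X k) j_incl"
    unfolding factors_through_def j_incl_def by blast
qed

lemma k2_in_Eq_rel: "k2 X k ` carrier K \<subseteq> Eq_rel X f"
  using k2_hom by (auto simp: monoid_hom_def hom_def Eq_monoid_def)

text \<open>The flipped pair \<open>(1, k a)\<close> always lies in \<open>R_rel\<close>, as
  \<open>k a = k a * 1\<close>.\<close>

lemma sym_R_rel_imp_k2_in_R_rel:
  assumes "sym (R_rel K X k)"
  shows "k2 X k ` carrier K \<subseteq> R_rel K X k"
proof -
  have "(\<one>\<^bsub>X\<^esub>, k a) \<in> R_rel K X k" if "a \<in> carrier K" for a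
    using that monoid_X
    by (auto simp: R_rel_def k_closed monoid.one_closed monoid.r_one intro!: bexI[of _ a])
  then show ?thesis
    using assms by (auto simp: k2_def dest: symD)
qed

end

lemma sym_Eq_rel: "sym (Eq_rel X f)"
  by (auto simp: sym_def Eq_rel_def)

context schreier_extension
begin

lemma R_rel_eq_Eq_rel_if_group:
  assumes "group K"
  shows "R_rel K X k = Eq_rel X f"
proof
  interpret X: monoid X by (rule monoid_X)
  interpret K: group K by fact
  show "Eq_rel X f \<subseteq> R_rel K X k"
  proof (rule subrelI)
    fix x y assume "(x, y) \<in> Eq_rel X f"
    then have x: "x \<in> carrier X" and y: "y \<in> carrier X" "f y = f x"
      by (auto simp: Eq_rel_def)
    obtain u where u: "u \<in> carrier X"
      and ex: "\<And>z. \<lbrakk>z \<in> carrier X; f z = f x\<rbrakk> \<Longrightarrow> \<exists>a\<in>carrier K. z = k a \<otimes>\<^bsub>X\<^esub> u"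
      using schreier f_closed[OF x] by (metis (no_types, lifting))
    obtain a where a: "a \<in> carrier K" "x = k a \<otimes>\<^bsub>X\<^esub> u" using ex x by blast
    obtain b where b: "b \<in> carrier K" "y = k b \<otimes>\<^bsub>X\<^esub> u" using ex y by blast
    let ?c = "b \<otimes>\<^bsub>K\<^esub> inv\<^bsub>K\<^esub> a"
    have "k ?c \<otimes>\<^bsub>X\<^esub> x = k (?c \<otimes>\<^bsub>K\<^esub> a) \<otimes>\<^bsub>X\<^esub> u"
      \<comment> \<open>Associativity in \<open>K\<close> is kept out so that \<open>k_mult\<close>
        splits both sides into the same product in \<open>X\<close>, before \<open>?c * a\<close>
        can collapse to \<open>b\<close>.\<close>
      unfolding a(2) using a(1) b(1) u by (simp add: X.m_assoc k_closed k_mult del: K.m_assoc)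
    also have "\<dots> = y"
      using a(1) b by (simp add: K.m_assoc)
    finally show "(x, y) \<in> R_rel K X k"
      using x y a(1) b(1) by (auto simp: R_rel_def intro!: bexI[of _ ?c])
  qed
qed (rule R_rel_subset_Eq_rel)

text \<open>An inclusion is injective with image its domain, so only equality of the carriers is
  left to decide bijectivity.\<close>

lemma j_incl_iso_iff:
  "j_incl \<in> iso (R_monoid K X k) (Eq_monoid X f) \<longleftrightarrow> R_rel K X k = Eq_rel X f"
  using j_incl_hom
  by (auto simp: iso_def bij_betw_def inj_on_def j_incl_def monoid_hom_def R_monoid_def Eq_monoid_def)

end

theorem corollary5p3:
  fixes K :: "('a, 'k) monoid_scheme"
    and X :: "('b, 'x) monoid_scheme"
    and M :: "('c, 'm) monoid_scheme"
    and k :: "'a \<Rightarrow> 'b" and f :: "'b \<Rightarrow> 'c"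
  assumes "schreier_extension K X M k f"
    and "comm_monoid K"
  shows "(factors_through K (R_monoid K X k) (k2 X k) j_incl \<longleftrightarrow>
            j_incl \<in> iso (R_monoid K X k) (Eq_monoid X f)) \<and>
         (j_incl \<in> iso (R_monoid K X k) (Eq_monoid X f) \<longleftrightarrow> sym (R_rel K X k)) \<and>
         (sym (R_rel K X k) \<longleftrightarrow> group K)"
proof -
  interpret schreier_extension K X M k f by fact
  \<comment> \<open>Every condition is compared with \<open>group K\<close>. If the two relations
    agree, \<open>k2\<close> lands in \<open>R_rel\<close> because it always lands in
    \<open>Eq_rel\<close>.\<close>
  have "R_rel K X k = Eq_rel X f \<longleftrightarrow> group K"
    using R_rel_eq_Eq_rel_if_group group_K_iff_k2_in_R_rel k2_in_Eq_rel by metis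
  \<comment> \<open>For a group, \<open>R_rel\<close> inherits symmetry from \<open>Eq_rel\<close>,
    to which it is equal.\<close>
  moreover have "sym (R_rel K X k) \<longleftrightarrow> group K"
    using R_rel_eq_Eq_rel_if_group sym_Eq_rel sym_R_rel_imp_k2_in_R_rel group_K_iff_k2_in_R_rel
    by metis
  ultimately show ?thesis
    using factors_through_j_incl_iff group_K_iff_k2_in_R_rel j_incl_iso_iff by simp
qed

end
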